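(* Let $F\colon \mathbb{R}^n\rightrightarrows \mathbb{R}^p$ and $G\colon \mathbb{R}^p\rightrightarrows \mathbb{R}^q$ be nearly convex set-valued mappings. Suppose that $$\mathrm{ri}(\mathrm{rge}\, F)\cap \mathrm{ri}(\mathrm{dom}\, G)\neq\emptyset.$$ Then $G\circ F\colon \mathbb{R}^n\rightrightarrows \mathbb{R}^q$ is nearly convex.
   Context: A set $\Omega\subset\mathbb{R}^k$ is nearly convex if there exists a convex set $C\subset\mathbb{R}^k$ such that $C\subset\Omega\subset\overline{C}$, where $\overline{C}$ is the closure of $C$. For an arbitrary set $\Omega\subset\mathbb{R}^k$, the relative interior is $\mathrm{ri}\,\Omega=\{a\in\Omega \mid \text{there exists } \delta>0 \text{ with } B(a;\delta)\cap \mathrm{aff}\,\Omega\subset\Omega\}$, where $\mathrm{aff}\,\Omega$ is the affine hull and $B(a;\delta)$ the open ball. A set-valued mapping $F\colon\mathbb{R}^n\rightrightarrows\mathbb{R}^p$ assigns to each $x\in\mathbb{R}^n$ a (possibly empty) subset $F(x)\subset\mathbb{R}^p$; $\mathrm{dom}\,F=\{x\mid F(x)\neq\emptyset\}$, $\mathrm{rge}\,F=\bigcup_{x\in\mathbb{R}^n}F(x)$, and $\mathrm{gph}\,F=\{(x,y)\in\mathbb{R}^n\times\mathbb{R}^p\mid y\in F(x)\}$. $F$ is nearly convex if $\mathrm{gph}\,F$ is a nearly convex set. The composition is $(G\circ F)(x)=\bigcup_{y\in F(x)}G(y)$. *)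

theory Defs
  imports "HOL-Analysis.Analysis"
begin

definition nearly_convex :: "'a::real_normed_vector set \<Rightarrow> bool" where
  "nearly_convex S \<longleftrightarrow> (\<exists>C. convex C \<and> C \<subseteq> S \<and> S \<subseteq> closure C)"

(* A set-valued mapping is a function into sets; empty values are allowed. *)

definition sv_dom :: "('a \<Rightarrow> 'b set) \<Rightarrow> 'a set" where
  "sv_dom F = {x. F x \<noteq> {}}"

definition sv_rge :: "('a \<Rightarrow> 'b set) \<Rightarrow> 'b set" where
  "sv_rge F = (\<Union>x. F x)"

definition sv_gph :: "('a \<Rightarrow> 'b set) \<Rightarrow> ('a \<times> 'b) set" where
  "sv_gph F = {(x, y). y \<in> F x}"

definition sv_comp :: "('b \<Rightarrow> 'c set) \<Rightarrow> ('a \<Rightarrow> 'b set) \<Rightarrow> 'a \<Rightarrow> 'c set" where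
  "sv_comp G F = (\<lambda>x. \<Union>y\<in>F x. G y)"

definition sv_nearly_convex ::
    "('a::real_normed_vector \<Rightarrow> 'b::real_normed_vector set) \<Rightarrow> bool" where
  "sv_nearly_convex F \<longleftrightarrow> nearly_convex (sv_gph F)"

end

theory Submission
  imports Defs
begin

text \<open>
  The graph of \<open>G \<circ> F\<close> is a linear image of \<open>gph F \<times> gph G\<close> cut by the subspace
  \<open>{((x, y), (y', z)). y = y'}\<close>. Near convexity passes to products, to linear images, and to
  intersections with an affine set that meets the relative interior. As relative interiors of
  nearly convex sets commute with linear images, a common point of \<open>ri (rge F)\<close> and
  \<open>ri (dom G)\<close> lifts to a point of \<open>ri (gph F) \<times> ri (gph G)\<close> lying in that subspace.
\<close>

text \<open>Passing to the closure changes neither the affine hull nor, for convex \<open>C\<close>,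
  the relative interior. As \<open>rel_interior\<close> is monotone between sets with equal affine
  hulls, \<open>S\<close> is squeezed. This transfers facts about convex sets to nearly convex
  ones.\<close>

lemma rel_interior_sandwich:
  fixes S :: "'a::euclidean_space set"
  assumes "convex C" "C \<subseteq> S" "S \<subseteq> closure C"
  shows "rel_interior S = rel_interior C"
proof
  have S: "affine hull S = affine hull C"
    using hull_mono[OF assms(2), of affine] hull_mono[OF assms(3), of affine]
    by (simp add: subset_antisym)
  show "rel_interior C \<subseteq> rel_interior S"
    by (rule subset_rel_interior[OF assms(2) S[symmetric]])
  have "rel_interior S \<subseteq> rel_interior (closure C)"
    by (rule subset_rel_interior[OF assms(3)]) (simp add: S)
  then show "rel_interior S \<subseteq> rel_interior C"
    by (simp add: convex_rel_interior_closure[OF assms(1)])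
qed

lemma nearly_convex_Times:
  assumes "nearly_convex S" "nearly_convex T"
  shows "nearly_convex (S \<times> T)"
proof -
  obtain C D where "convex C" "C \<subseteq> S" "S \<subseteq> closure C" "convex D" "D \<subseteq> T" "T \<subseteq> closure D"
    using assms unfolding nearly_convex_def by auto
  then have "convex (C \<times> D)" "C \<times> D \<subseteq> S \<times> T" "S \<times> T \<subseteq> closure (C \<times> D)"
    by (auto simp: closure_Times intro: convex_Times)
  then show ?thesis
    unfolding nearly_convex_def by blast
qed

text \<open>The second inclusion is continuity of linear maps in finite dimension; so
  \<open>f\<close> C\<open>can serve as the convex core of\<close>f \<open>S\<close>.\<close>

lemma linear_image_sandwich:
  fixes f :: "'a::euclidean_space \<Rightarrow> 'b::real_normed_vector"
  assumes "linear f" "C \<subseteq> S" "S \<subseteq> closure C"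
  shows "f ` C \<subseteq> f ` S" "f ` S \<subseteq> closure (f ` C)"
  using assms(2) image_mono[OF assms(3), of f] closure_linear_image_subset[OF assms(1), of C]
  by auto

lemma nearly_convex_linear_image:
  fixes f :: "'a::euclidean_space \<Rightarrow> 'b::real_normed_vector"
  assumes "linear f" "nearly_convex S"
  shows "nearly_convex (f ` S)"
  using assms linear_image_sandwich[OF assms(1)] convex_linear_image[OF assms(1)]
  unfolding nearly_convex_def by meson

text \<open>Both sides depend only on the convex core \<open>C\<close>, so the identity reduces to
  its convex case.\<close>

lemma rel_interior_nearly_convex_linear_image:
  fixes f :: "'a::euclidean_space \<Rightarrow> 'b::euclidean_space"
  assumes "linear f" "nearly_convex S"
  shows "rel_interior (f ` S) = f ` rel_interior S"
proof -
  obtain C where C: "convex C" "C \<subseteq> S" "S \<subseteq> closure C"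
    using assms(2) unfolding nearly_convex_def by auto
  have "rel_interior (f ` S) = rel_interior (f ` C)"
    using linear_image_sandwich[OF assms(1) C(2,3)] convex_linear_image[OF assms(1) C(1)]
    by (intro rel_interior_sandwich)
  also have "\<dots> = f ` rel_interior S"
    using rel_interior_convex_linear_image[OF assms(1) C(1)] rel_interior_sandwich[OF C] by simp
  finally show ?thesis .
qed

lemma rel_interior_nearly_convex_Times:
  fixes S :: "'a::euclidean_space set" and T :: "'b::euclidean_space set"
  assumes "nearly_convex S" "nearly_convex T"
  shows "rel_interior (S \<times> T) = rel_interior S \<times> rel_interior T"
proof -
  obtain C D where C: "convex C" "C \<subseteq> S" "S \<subseteq> closure C" and D: "convex D" "D \<subseteq> T" "T \<subseteq> closure D"
    using assms unfolding nearly_convex_def by auto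
  have "rel_interior (S \<times> T) = rel_interior (C \<times> D)"
    using C D by (intro rel_interior_sandwich) (auto simp: closure_Times intro: convex_Times)
  then show ?thesis
    using rel_interior_Times[OF C(1) D(1)] rel_interior_sandwich[OF C] rel_interior_sandwich[OF D]
    by simp
qed

text \<open>The core is \<open>C \<inter> L\<close>. A point of \<open>L\<close> in the relative
  interior is what makes closure commute with the cut. If \<open>L\<close> only touched the
  boundary, \<open>S \<inter> L\<close> could be arbitrary: an open half-plane with two boundary
  points added, cut by its boundary line, leaves just these two points.\<close>

lemma nearly_convex_Int_affine:
  fixes S :: "'a::euclidean_space set"
  assumes "nearly_convex S" "affine L" "rel_interior S \<inter> L \<noteq> {}"
  shows "nearly_convex (S \<inter> L)"
proof -
  obtain C where C: "convex C" "C \<subseteq> S" "S \<subseteq> closure C"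
    using assms(1) unfolding nearly_convex_def by auto
  have "closure (C \<inter> L) = closure C \<inter> L"
    using convex_affine_closure_Int[OF C(1) assms(2)] assms(3) rel_interior_sandwich[OF C] by simp
  then have "S \<inter> L \<subseteq> closure (C \<inter> L)"
    using C(3) by auto
  moreover have "convex (C \<inter> L)"
    using C(1) assms(2) by (simp add: convex_Int affine_imp_convex)
  ultimately show ?thesis
    using C(2) unfolding nearly_convex_def by blast
qed

theorem theorem4p6:
  fixes F :: "real ^ 'n \<Rightarrow> (real ^ 'p) set"
    and G :: "real ^ 'p \<Rightarrow> (real ^ 'q) set"
  assumes "sv_nearly_convex F"
    and "sv_nearly_convex G"
    and "rel_interior (sv_rge F) \<inter> rel_interior (sv_dom G) \<noteq> {}"
  shows "sv_nearly_convex (sv_comp G F)"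
proof -
  have F: "nearly_convex (sv_gph F)" and G: "nearly_convex (sv_gph G)"
    using assms(1,2) unfolding sv_nearly_convex_def by auto
  define L :: "(((real^'n) \<times> (real^'p)) \<times> ((real^'p) \<times> (real^'q))) set"
    where "L = {w. snd (fst w) = fst (snd w)}"
  define f :: "((real^'n) \<times> (real^'p)) \<times> ((real^'p) \<times> (real^'q)) \<Rightarrow> (real^'n) \<times> (real^'q)"
    where "f = (\<lambda>w. (fst (fst w), snd (snd w)))"
  have "linear f"
    unfolding f_def by (rule linearI) auto
  have "affine L"
    unfolding L_def affine_def by auto
  \<comment> \<open>Range and domain are projections of the graphs, so the relative interiors in the
    hypothesis become projections of those of the graphs.\<close>
  have "sv_rge F = snd ` sv_gph F"
    by (auto simp: sv_rge_def sv_gph_def image_iff Bex_def)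
  moreover have "sv_dom G = fst ` sv_gph G"
    by (auto simp: sv_dom_def sv_gph_def image_iff Bex_def)
  ultimately have "rel_interior (sv_rge F) = snd ` rel_interior (sv_gph F)"
    "rel_interior (sv_dom G) = fst ` rel_interior (sv_gph G)"
    using rel_interior_nearly_convex_linear_image[OF linear_snd F]
      rel_interior_nearly_convex_linear_image[OF linear_fst G] by auto
  then obtain u v where "u \<in> rel_interior (sv_gph F)" "v \<in> rel_interior (sv_gph G)" "snd u = fst v"
    using assms(3) by auto
  then have "(u, v) \<in> rel_interior (sv_gph F \<times> sv_gph G) \<inter> L"
    unfolding rel_interior_nearly_convex_Times[OF F G] L_def by simp
  then have "nearly_convex (sv_gph F \<times> sv_gph G \<inter> L)"
    using nearly_convex_Int_affine[OF nearly_convex_Times[OF F G] \<open>affine L\<close>] by blast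
  then have "nearly_convex (f ` (sv_gph F \<times> sv_gph G \<inter> L))"
    by (rule nearly_convex_linear_image[OF \<open>linear f\<close>])
  \<comment> \<open>Since \<open>f\<close> forgets the intermediate point, a preimage must restore
    it: \<open>y\<close> is placed in both middle slots, which puts the pair in
    \<open>L\<close>.\<close>
  moreover have "(x, z) \<in> f ` (sv_gph F \<times> sv_gph G \<inter> L)" if "y \<in> F x" "z \<in> G y" for x y z
    using that by (intro image_eqI[of _ f "((x, y), (y, z))"]) (auto simp: f_def L_def sv_gph_def)
  then have "f ` (sv_gph F \<times> sv_gph G \<inter> L) = sv_gph (sv_comp G F)"
    by (auto simp: f_def L_def sv_gph_def sv_comp_def)
  ultimately show ?thesis
    unfolding sv_nearly_convex_def by simp
qed

end
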